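(* Let $p$ be an odd prime. For $d\in\mathbb{Z}$ define $$R(d,p):=\det\left[\left(\frac{i+dj}{p}\right)\right]_{0\leqslant i,j\leqslant (p-1)/2}.$$ If $p\equiv 1\pmod 4$, then for every $d\in\mathbb{Z}$, $$R(d,p)\equiv\left(\left(\frac dp\right)d\right)^{(p-1)/4}\cdot\left(\frac{p-1}{2}\right)!\pmod p.$$ If $p\equiv 3\pmod 4$, then $$R(d,p)\equiv\left(\frac 2p\right)\pmod p\ \text{ if } \left(\frac dp\right)=1,\qquad R(d,p)\equiv 1\pmod p\ \text{ if }\left(\frac dp\right)=-1.$$ Moreover, for all $d\in\mathbb{Z}$, $$R(-d,p)\equiv\left(\frac 2p\right)R(d,p)\pmod p,$$ and for all $c,d\in\mathbb{Z}$, $$\det\left[\left(\frac{i+dj+c}{p}\right)\right]_{0\leqslant i,j\leqslant (p-1)/2}\equiv R(d,p)\pmod p.$$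
   Context: $\left(\frac{\cdot}{p}\right)$ denotes the Legendre symbol modulo $p$ (with $\left(\frac{a}{p}\right)=0$ when $p\mid a$). $\det[a_{ij}]_{0\leqslant i,j\leqslant n}$ denotes the determinant of the $(n+1)\times(n+1)$ matrix with entries $a_{ij}$. *)

theory Defs
  imports "HOL-Number_Theory.Quadratic_Reciprocity" "Jordan_Normal_Form.Determinant"
begin

definition R :: "int \<Rightarrow> nat \<Rightarrow> int" where
  "R d p = det (mat ((p - 1) div 2 + 1) ((p - 1) div 2 + 1)
     (\<lambda>(i, j). Legendre (int i + d * int j) (int p)))"

end

theory Submission
  imports Defs
begin

text \<open>
  Put \<open>n = (p - 1) / 2\<close>. By Euler's criterion the matrix is congruent to the one with entries
  \<open>(i + y_j)^n\<close>, where \<open>y_j = c + d j\<close>. The binomial theorem factors the latter through a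
  diagonal matrix of binomial coefficients and two Vandermonde matrices, one of them with its
  powers in reversed order. Hence its determinant is \<open>n!^(n+1) (-d)^(n(n+1)/2)\<close>, independently of
  \<open>c\<close>. The congruences follow from \<open>n!^2 \<equiv> (-1)^(n+1)\<close> (Wilson), from Euler's criterion for
  \<open>d^n\<close>, and from \<open>(2/p) = (-1)^(n(n+1)/2)\<close> (Gauss' lemma).
\<close>

section \<open>Vandermonde determinants\<close>

text \<open>
  Coefficients of a power in the Newton basis of products of \<open>t - x l\<close> over \<open>l < m\<close>. In this
  basis the Vandermonde matrix is a lower triangular matrix times a unitriangular one.
\<close>

fun newton_coeff :: "(nat \<Rightarrow> 'a :: comm_ring_1) \<Rightarrow> nat \<Rightarrow> nat \<Rightarrow> 'a" where
  "newton_coeff x 0 0 = 1"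
| "newton_coeff x 0 (Suc m) = 0"
| "newton_coeff x (Suc k) 0 = x 0 * newton_coeff x k 0"
| "newton_coeff x (Suc k) (Suc m) = newton_coeff x k m + x (Suc m) * newton_coeff x k (Suc m)"

lemma newton_coeff_eq_0: "k < m \<Longrightarrow> newton_coeff x k m = 0"
  by (induction x k m rule: newton_coeff.induct) auto

lemma newton_coeff_diag: "newton_coeff x k k = 1"
  by (induction k) (auto simp: newton_coeff_eq_0)

text \<open>Multiplying the \<open>m\<close>-th basis product by \<open>t = (t - x m) + x m\<close>
  gives the next product plus \<open>x m\<close> times the same one; this is the recursion of
  \<open>newton_coeff\<close>.\<close>

lemma power_newton_expansion:
  fixes t :: "'a :: comm_ring_1"
  shows "t ^ k = (\<Sum>m\<le>k. newton_coeff x k m * (\<Prod>l<m. t - x l))"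
proof (induction k)
  case (Suc k)
  let ?N = "\<lambda>m. \<Prod>l<m. t - x l"
  have "(\<Sum>m\<le>Suc k. newton_coeff x (Suc k) m * ?N m)
      = x 0 * newton_coeff x k 0 + (\<Sum>m\<le>k. newton_coeff x k m * ?N (Suc m))
        + (\<Sum>m\<le>k. x (Suc m) * newton_coeff x k (Suc m) * ?N (Suc m))"
    by (simp add: sum.atMost_Suc_shift algebra_simps sum.distrib del: sum.atMost_Suc prod.lessThan_Suc)
  also have "\<dots> = (\<Sum>m\<le>k. newton_coeff x k m * ?N (Suc m))
        + (\<Sum>m\<le>Suc k. x m * newton_coeff x k m * ?N m)"
    by (simp add: sum.atMost_Suc_shift del: sum.atMost_Suc prod.lessThan_Suc)
  also have "\<dots> = (\<Sum>m\<le>k. newton_coeff x k m * ?N (Suc m))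
        + (\<Sum>m\<le>k. x m * newton_coeff x k m * ?N m)"
    by (simp add: newton_coeff_eq_0)
  also have "\<dots> = (\<Sum>m\<le>k. t * (newton_coeff x k m * ?N m))"
    by (simp add: sum.distrib[symmetric] algebra_simps)
  finally show ?case
    using Suc by (simp add: sum_distrib_left)
qed simp

lemma det_vandermonde:
  fixes x :: "nat \<Rightarrow> 'a :: idom"
  shows "det (mat N N (\<lambda>(i, j). x i ^ j)) = (\<Prod>k<N. \<Prod>l<k. x k - x l)"
proof -
  define T where "T = mat N N (\<lambda>(i, m). \<Prod>l<m. x i - x l)"
  define U where "U = mat N N (\<lambda>(m, j). newton_coeff x j m)"
  have carrier: "T \<in> carrier_mat N N" "U \<in> carrier_mat N N"
    by (auto simp: T_def U_def)
  have "mat N N (\<lambda>(i, j). x i ^ j) = T * U"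
  proof (rule eq_matI)
    fix i j assume "i < dim_row (T * U)" "j < dim_col (T * U)"
    then have ij: "i < N" "j < N" by (auto simp: T_def U_def)
    have "x i ^ j = (\<Sum>m\<le>j. (\<Prod>l<m. x i - x l) * newton_coeff x j m)"
      using power_newton_expansion[of "x i" j x] by (simp add: mult.commute)
    also have "\<dots> = (\<Sum>m<N. (\<Prod>l<m. x i - x l) * newton_coeff x j m)"
      using ij by (intro sum.mono_neutral_left) (auto simp: newton_coeff_eq_0)
    finally show "mat N N (\<lambda>(i, j). x i ^ j) $$ (i, j) = (T * U) $$ (i, j)"
      using ij by (simp add: T_def U_def scalar_prod_def atLeast0LessThan)
  qed (auto simp: T_def U_def)
  then have "det (mat N N (\<lambda>(i, j). x i ^ j)) = det T * det U"
    using carrier by (simp add: det_mult)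
  \<comment> \<open>For \<open>m > i\<close> the entry of \<open>T\<close> at \<open>(i, m)\<close>
    contains the factor \<open>x i - x i\<close>.\<close>
  moreover have "det T = (\<Prod>k<N. \<Prod>l<k. x k - x l)"
    using carrier(1)
    by (subst det_lower_triangular[of N])
      (auto simp: T_def prod_list_diag_prod atLeast0LessThan prod_zero_iff)
  moreover have "det U = 1"
    using carrier(2)
    by (subst det_upper_triangular[of _ N])
      (auto simp: U_def prod_list_diag_prod newton_coeff_eq_0 newton_coeff_diag)
  ultimately show ?thesis by simp
qed

text \<open>Serves for the columns, with nodes \<open>c + d * j\<close>, and with
  \<open>d = -1\<close> for the reversed row nodes \<open>n - i\<close>.\<close>

lemma det_vandermonde_arith:
  fixes a d :: "'a :: {idom, semiring_char_0}"
  shows "det (mat N N (\<lambda>(i, j). (a + d * of_nat i) ^ j)) = (\<Prod>k<N. d ^ k * fact k)"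
proof -
  have "(\<Prod>l<k. (a + d * of_nat k) - (a + d * of_nat l)) = d ^ k * fact k" for k
  proof -
    have "(\<Prod>l<k. (a + d * of_nat k) - (a + d * of_nat l)) = (\<Prod>l<k. d * of_nat (k - l))"
      by (intro prod.cong) (auto simp: of_nat_diff algebra_simps)
    then show ?thesis
      by (simp add: prod.distrib fact_prod_rev atLeast0LessThan)
  qed
  then show ?thesis by (simp add: det_vandermonde)
qed

section \<open>The determinant of powers of sums\<close>

text \<open>Reflecting \<open>k\<close> to \<open>n - k\<close> in one of the two factorial products
  turns each factor into \<open>(n choose k) * fact k * fact (n - k) = fact n\<close>.\<close>

lemma prod_binomial_fact_sq:
  "(\<Prod>k\<le>n. of_nat (n choose k) * fact k * fact k) = (fact n ^ Suc n :: 'a :: {idom, semiring_char_0})"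
proof -
  have "(\<Prod>k\<le>n. fact k :: 'a) = (\<Prod>k\<le>n. fact (n - k))"
    by (rule prod.nat_diff_reindex[symmetric, of fact "Suc n", simplified lessThan_Suc_atMost, simplified])
  then have "(\<Prod>k\<le>n. of_nat (n choose k) * fact k * fact k :: 'a)
      = (\<Prod>k\<le>n. of_nat (fact k * fact (n - k) * (n choose k)))"
    by (simp add: prod.distrib)
  also have "\<dots> = (\<Prod>k\<le>n. of_nat (fact n))"
    by (intro prod.cong) (simp_all add: binomial_fact_lemma del: of_nat_mult)
  finally show ?thesis by simp
qed

lemma det_power_sum:
  fixes c d :: "'a :: {idom, semiring_char_0}"
  shows "det (mat (Suc n) (Suc n) (\<lambda>(i, j). (of_nat i + (c + d * of_nat j)) ^ n))
    = fact n ^ Suc n * (- d) ^ (n * Suc n div 2)"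
proof -
  let ?N = "Suc n"
  define y where "y = (\<lambda>j. c + d * of_nat j)"
  define V where "V = mat ?N ?N (\<lambda>(i, k). (of_nat i :: 'a) ^ k)"
  define Y where "Y = mat ?N ?N (\<lambda>(j, k). y j ^ k)"
  define D where "D = mat ?N ?N (\<lambda>(k, l). if k = l then of_nat (n choose k) else (0 :: 'a))"
  define W where "W = mat ?N ?N (\<lambda>(k, j). y j ^ (n - k))"
  \<comment> \<open>The reversal of \<open>0..n\<close>, extended by the identity because
    \<open>permutes\<close> requires fixed points outside the set.\<close>
  define r where "r = (\<lambda>i. if i \<le> n then n - i else i)"
  have r: "r permutes {0..<?N}"
    unfolding r_def by (intro bij_imp_permutes bij_betwI[of _ _ _ "\<lambda>i. n - i"]) auto
  have V: "V \<in> carrier_mat ?N ?N" and Y: "Y \<in> carrier_mat ?N ?N"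
    and D: "D \<in> carrier_mat ?N ?N" and W: "W \<in> carrier_mat ?N ?N"
    by (auto simp: V_def Y_def D_def W_def)
  have DW: "D * W = mat ?N ?N (\<lambda>(k, j). of_nat (n choose k) * y j ^ (n - k))"
    by (rule eq_matI) (auto simp: D_def W_def scalar_prod_def if_distrib[of "\<lambda>z. z * _"] sum.delta'
        cong: if_cong simp del: sum.op_ivl_Suc)
  have "mat ?N ?N (\<lambda>(i, j). (of_nat i + y j) ^ n) = V * (D * W)"
    unfolding DW
    by (rule eq_matI)
      (auto simp: V_def scalar_prod_def binomial_ring atLeast0LessThan lessThan_Suc_atMost
        algebra_simps simp del: sum.atMost_Suc sum.lessThan_Suc intro!: sum.cong)
  then have "det (mat ?N ?N (\<lambda>(i, j). (of_nat i + (c + d * of_nat j)) ^ n)) = det V * (det D * det W)"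
    using V D W by (simp add: det_mult y_def)
  also have "det D = (\<Prod>k\<le>n. of_nat (n choose k))"
    using D by (subst det_lower_triangular[of ?N])
      (auto simp: D_def prod_list_diag_prod atLeast0LessThan lessThan_Suc_atMost simp del: prod.lessThan_Suc prod.op_ivl_Suc)
  also have "det W = signof r * det Y"
  proof -
    \<comment> \<open>Row \<open>k\<close> of \<open>W\<close> holds the powers with exponent
      \<open>n - k\<close>, so \<open>W\<close> is the transpose of \<open>Y\<close> with its rows
      reversed.\<close>
    have "W = mat ?N ?N (\<lambda>(i, j). transpose_mat Y $$ (r i, j))"
      by (rule eq_matI) (auto simp: W_def Y_def r_def)
    then show ?thesis
      using det_permute_rows[OF _ r, of "transpose_mat Y"] Y by (simp add: det_transpose)
  qed
  also have "det V * ((\<Prod>k\<le>n. of_nat (n choose k)) * (signof r * det Y))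
      = (signof r * det V) * (\<Prod>k\<le>n. of_nat (n choose k)) * det Y"
    by (simp add: algebra_simps)
  \<comment> \<open>The reversal turns the nodes \<open>i\<close> into \<open>n - i\<close>, so its sign need not be computed.\<close>
  also have "signof r * det V = (\<Prod>k\<le>n. (- 1) ^ k * fact k)"
  proof -
    have "signof r * det V = det (mat ?N ?N (\<lambda>(i, j). V $$ (r i, j)))"
      using det_permute_rows[OF V r] by simp
    also have "mat ?N ?N (\<lambda>(i, j). V $$ (r i, j)) = mat ?N ?N (\<lambda>(i, j). (of_nat n + (- 1) * of_nat i) ^ j)"
      by (rule eq_matI) (auto simp: V_def r_def of_nat_diff)
    finally show ?thesis
      by (simp only: det_vandermonde_arith lessThan_Suc_atMost)
  qed
  also have "det Y = (\<Prod>k\<le>n. d ^ k * fact k)"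
    by (simp only: Y_def y_def det_vandermonde_arith lessThan_Suc_atMost)
  also have "(\<Prod>k\<le>n. (- 1) ^ k * fact k) * (\<Prod>k\<le>n. of_nat (n choose k)) * (\<Prod>k\<le>n. d ^ k * fact k)
      = (\<Prod>k\<le>n. of_nat (n choose k) * fact k * fact k) * (\<Prod>k\<le>n. (- d) ^ k)"
    by (simp only: prod.distrib power_minus[of d] mult_ac)
  also have "\<dots> = fact n ^ Suc n * (- d) ^ (n * Suc n div 2)"
    unfolding prod_binomial_fact_sq
    by (simp only: power_sum[symmetric] atMost_atLeast0 gauss_sum_nat)
  finally show ?thesis .
qed

section \<open>Congruences modulo a prime\<close>

text \<open>By the Leibniz formula the determinant is an integer polynomial in the entries.\<close>

lemma det_cong_mod:
  fixes A B :: "int mat"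
  assumes A: "A \<in> carrier_mat n n" and B: "B \<in> carrier_mat n n"
    and cong: "\<And>i j. i < n \<Longrightarrow> j < n \<Longrightarrow> [A $$ (i, j) = B $$ (i, j)] (mod m)"
  shows "[det A = det B] (mod m)"
  unfolding det_def'[OF A] det_def'[OF B]
  by (intro cong_sum cong_mult cong_prod cong_refl cong)
    (auto dest: permutes_in_image)

lemma Legendre_two:
  fixes p :: nat
  assumes "prime p" "2 < p"
  defines "n \<equiv> (p - 1) div 2"
  shows "Legendre 2 (int p) = (- 1) ^ (n * Suc n div 2)"
proof -
  have "odd p" using assms prime_odd_nat by blast
  then have p: "p = 2 * n + 1" unfolding n_def by presburger
  interpret GAUSS p 2
    using assms by unfold_locales (auto simp: cong_def)
  \<comment> \<open>The doubles of \<open>1..n\<close> stay below \<open>p\<close>, so reduction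
    does not alter them, and \<open>2 * x > n\<close> means \<open>x > n div 2\<close>.\<close>
  have "E = (\<lambda>x. x * 2) ` {int (n div 2) <.. int n}"
  proof -
    have "C = (\<lambda>x. x * 2) ` {0 <.. int n}"
      unfolding C_def B_def A_def image_image by (intro image_cong) (auto simp: p)
    then show ?thesis unfolding E_def by (auto simp: p zdiv_int)
  qed
  then have "card E = n - n div 2"
    by (simp add: card_image inj_on_def)
  \<comment> \<open>Both parities depend only on \<open>n\<close> modulo 4.\<close>
  moreover have "even (n - n div 2) \<longleftrightarrow> even (n * Suc n div 2)"
  proof -
    obtain q r where "n = 4 * q + r" "r < 4"
      by (metis mod_less_divisor mult_div_mod_eq zero_less_numeral)
    moreover have "r \<in> {0, 1, 2, 3}" using \<open>r < 4\<close> by auto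
    moreover have "n div 2 = 2 * q + r div 2"
      using \<open>n = 4 * q + r\<close> by simp
    ultimately show ?thesis by (auto simp: algebra_simps)
  qed
  ultimately show ?thesis
    unfolding gauss_lemma by (simp add: minus_one_power_iff)
qed

text \<open>Folding the upper half of \<open>fact (p - 1)\<close> onto the lower by \<open>k\<close>
  to \<open>p - k\<close> costs the sign \<open>(- 1) ^ n\<close>; Wilson's theorem gives the value
  \<open>- 1\<close>.\<close>

lemma fact_half_squared_cong:
  fixes p :: nat
  assumes "prime p" "2 < p"
  defines "n \<equiv> (p - 1) div 2"
  shows "[(fact n)\<^sup>2 = (- 1) ^ Suc n] (mod int p)"
proof -
  have "odd p" using assms prime_odd_nat by blast
  then have p: "p = 2 * n + 1" unfolding n_def by presburger
  have "{1..2 * n} = {1..n} \<union> {n + 1..2 * n}" by auto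
  then have "(fact (2 * n) :: int) = (\<Prod>k=1..n. int k) * (\<Prod>k=n + 1..2 * n. int k)"
    by (simp add: fact_prod prod.union_disjoint)
  also have "(\<Prod>k=n + 1..2 * n. int k) = (\<Prod>k=1..n. int (p - k))"
    by (rule prod.reindex_bij_witness[of _ "\<lambda>k. p - k" "\<lambda>k. p - k"]) (auto simp: p)
  finally have "fact (p - 1) = (\<Prod>k=1..n. int k) * (\<Prod>k=1..n. int (p - k))"
    by (simp add: p)
  moreover have "[(\<Prod>k=1..n. int (p - k)) = (\<Prod>k=1..n. - 1 * int k)] (mod int p)"
    by (intro cong_prod) (auto simp: p of_nat_diff cong_iff_dvd_diff)
  moreover have "(\<Prod>k=1..n. - 1 * int k) = (- 1) ^ n * fact n"
    by (subst prod.distrib) (simp add: fact_prod)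
  ultimately have "[fact (p - 1) = fact n * ((- 1) ^ n * fact n)] (mod int p)"
    by (simp add: fact_prod cong_scalar_left)
  moreover have "[fact (p - 1) = - 1] (mod int p)"
    using wilson_theorem[OF assms(1)] by simp
  ultimately have "[fact n * ((- 1) ^ n * fact n) = - 1] (mod int p)"
    using cong_sym cong_trans by blast
  then have "[(- 1) ^ n * (fact n * ((- 1) ^ n * fact n)) = (- 1) ^ n * - 1] (mod int p)"
    by (rule cong_scalar_left)
  moreover have "(- 1) ^ n * (fact n * ((- 1) ^ n * fact n)) = (fact n :: int)\<^sup>2"
    by (simp add: minus_one_power_iff power2_eq_square)
  ultimately show ?thesis by simp
qed

text \<open>Euler's criterion also covers entries divisible by \<open>p\<close>, where both sides
  vanish modulo \<open>p\<close>. Since \<open>c\<close> is absent from the right-hand side, the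
  shifted determinants all agree with \<open>R d p\<close>.\<close>

lemma det_Legendre_cong:
  fixes p :: nat and c d :: int
  assumes "prime p" "2 < p"
  defines "n \<equiv> (p - 1) div 2"
  shows "[det (mat (n + 1) (n + 1) (\<lambda>(i, j). Legendre (int i + d * int j + c) (int p)))
    = fact n ^ Suc n * (- d) ^ (n * Suc n div 2)] (mod int p)"
proof -
  have "[det (mat (Suc n) (Suc n) (\<lambda>(i, j). Legendre (int i + d * int j + c) (int p)))
    = det (mat (Suc n) (Suc n) (\<lambda>(i, j). (int i + (c + d * int j)) ^ n))] (mod int p)"
    using euler_criterion[OF assms(1,2)]
    by (intro det_cong_mod[of _ "Suc n"]) (auto simp: n_def add_ac)
  then show ?thesis by (simp add: det_power_sum del: power_Suc)
qed

section \<open>Evaluation of R by residue class of p\<close>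

theorem theorem1p1:
  fixes p :: nat
  assumes "prime p" and "odd p"
  shows "([p = 1] (mod 4) \<longrightarrow>
            (\<forall>d::int. [R d p = (Legendre d (int p) * d) ^ ((p - 1) div 4) * fact ((p - 1) div 2)] (mod (int p))))
       \<and> ([p = 3] (mod 4) \<longrightarrow>
            (\<forall>d::int. (Legendre d (int p) = 1 \<longrightarrow> [R d p = Legendre 2 (int p)] (mod (int p)))
                    \<and> (Legendre d (int p) = -1 \<longrightarrow> [R d p = 1] (mod (int p)))))
       \<and> (\<forall>d::int. [R (- d) p = Legendre 2 (int p) * R d p] (mod (int p)))
       \<and> (\<forall>c d::int. [det (mat ((p - 1) div 2 + 1) ((p - 1) div 2 + 1)
                             (\<lambda>(i, j). Legendre (int i + d * int j + c) (int p)))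
                        = R d p] (mod (int p)))"
proof -
  define n where "n = (p - 1) div 2"
  define e where "e = n * Suc n div 2"
  have p2: "2 < p" using assms by (metis even_numeral le_neq_implies_less prime_ge_2_nat)
  have p: "p = 2 * n + 1" using \<open>odd p\<close> unfolding n_def by presburger
  have two: "Legendre 2 (int p) = (- 1) ^ e"
    using Legendre_two[OF assms(1) p2] by (simp add: e_def n_def)
  have shifted: "[det (mat ((p - 1) div 2 + 1) ((p - 1) div 2 + 1)
      (\<lambda>(i, j). Legendre (int i + d * int j + c) (int p))) = fact n ^ Suc n * (- d) ^ e] (mod int p)"
    for c d
    using det_Legendre_cong[OF assms(1) p2] by (simp add: e_def n_def)
  have R: "[R d p = fact n ^ Suc n * (- d) ^ e] (mod int p)" for d
    using shifted[of d 0] by (simp add: R_def)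
  have sq: "[(fact n)\<^sup>2 = (- 1) ^ Suc n] (mod int p)"
    using fact_half_squared_cong[OF assms(1) p2] by (simp add: n_def)
  have euler: "[d ^ n = Legendre d (int p)] (mod int p)" for d
    using euler_criterion[OF assms(1) p2] by (simp add: n_def cong_sym)
  have case1: "[R d p = (Legendre d (int p) * d) ^ ((p - 1) div 4) * fact ((p - 1) div 2)] (mod int p)"
    if "[p = 1] (mod 4)" for d
  proof -
    define m where "m = (p - 1) div 4"
    have n: "n = 2 * m" using that p unfolding m_def cong_def by presburger
    have "e = m * Suc n" by (simp add: e_def n)
    \<comment> \<open>With \<open>n = 2 * m\<close>, one factor \<open>fact n\<close> is split off
      and the rest grouped into \<open>m\<close>-th powers of \<open>(fact n)\<^sup>2\<close> and
      \<open>d ^ n * d\<close>, ready for Wilson and Euler. The sign is \<open>(- 1) ^ m\<close>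
      because \<open>Suc n\<close> is odd.\<close>
    then have "fact n ^ Suc n * (- d) ^ e = fact n * ((fact n)\<^sup>2 ^ m * (- 1) ^ m) * (d ^ n * d) ^ m"
      by (simp add: n power_minus[of d] power_mult_distrib power_mult[symmetric] power_add
          minus_one_power_iff algebra_simps)
    also have "[\<dots> = fact n * (((- 1) ^ Suc n) ^ m * (- 1) ^ m) * (Legendre d (int p) * d) ^ m] (mod int p)"
      by (intro cong_mult cong_pow cong_refl sq euler)
    also have "fact n * (((- 1) ^ Suc n) ^ m * (- 1) ^ m) * (Legendre d (int p) * d) ^ m
        = (Legendre d (int p) * d) ^ m * fact n"
      by (simp add: n minus_one_power_iff)
    finally show ?thesis
      using R[of d] cong_trans unfolding m_def n_def by blast
  qed
  \<comment> \<open>One formula for both values of the symbol: \<open>1\<close> leaves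
    \<open>(- 1) ^ e\<close>, which is \<open>Legendre 2 (int p)\<close>, and \<open>-1\<close>
    leaves \<open>1\<close>.\<close>
  have case3: "[R d p = (- Legendre d (int p)) ^ e] (mod int p)" if "[p = 3] (mod 4)" for d
  proof -
    define m where "m = Suc n div 2"
    have n: "Suc n = 2 * m" "odd n" using that p unfolding m_def cong_def by presburger+
    have e: "e = n * m" unfolding e_def n(1) by simp
    have "fact n ^ Suc n * (- d) ^ e = (fact n)\<^sup>2 ^ m * ((- 1) ^ n * d ^ n) ^ m"
      by (simp add: n e power_minus[of d n] power_mult flip: power_minus)
    also have "[\<dots> = ((- 1) ^ Suc n) ^ m * ((- 1) ^ n * Legendre d (int p)) ^ m] (mod int p)"
      by (intro cong_mult cong_pow cong_refl sq euler)
    also have "((- 1) ^ Suc n) ^ m * ((- 1) ^ n * Legendre d (int p)) ^ m = (- Legendre d (int p)) ^ m"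
      using n(2) by simp
    \<comment> \<open>The base is \<open>-1\<close>, \<open>0\<close> or \<open>1\<close>, hence
      unchanged by the odd power \<open>n\<close>, and \<open>e = n * m\<close>.\<close>
    also have "\<dots> = (- Legendre d (int p)) ^ e"
      using n(2) unfolding e power_mult by (auto simp: Legendre_def zero_power odd_pos)
    finally show ?thesis
      using R[of d] cong_trans by blast
  qed
  have neg: "[R (- d) p = Legendre 2 (int p) * R d p] (mod int p)" for d
  proof -
    \<comment> \<open>Negating \<open>d\<close> only introduces the sign \<open>(- 1) ^ e\<close>,
      which is \<open>Legendre 2 (int p)\<close> by \<open>two\<close>.\<close>
    have "fact n ^ Suc n * (- (- d)) ^ e = (- 1) ^ e * (fact n ^ Suc n * (- d) ^ e)"
      by (simp add: power_minus[of d] minus_one_power_iff)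
    also have "[\<dots> = (- 1) ^ e * R d p] (mod int p)"
      by (intro cong_scalar_left cong_sym[OF R])
    finally show ?thesis
      using R[of "- d"] cong_trans unfolding two by blast
  qed
  have plus: "[R d p = Legendre 2 (int p)] (mod int p)"
    if "[p = 3] (mod 4)" "Legendre d (int p) = 1" for d
    using case3[OF that(1), of d] that(2) by (simp add: two)
  have minus: "[R d p = 1] (mod int p)"
    if "[p = 3] (mod 4)" "Legendre d (int p) = -1" for d
    using case3[OF that(1), of d] that(2) by simp
  show ?thesis
    using case1 plus minus neg cong_trans[OF shifted cong_sym[OF R]] by blast
qed

end
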